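(* Let $1\le a<b\le\infty$, let $\psi\in\Psi(a,b)$, let $T$ be the linear integral operator with kernel $K$ described in the context, let $\nu(p)=\inf_{q\in(a,b)}\{|T|_{q\to p}\,\psi(q)\}$ and let $(c,d)$ be the associated interval. Then for every $f\in G(\psi)=G(\psi;a,b)$ (over $(S_2,\Sigma_2,\mu_2)$), $$\|Tf\|G(\nu)\le \|f\|G(\psi),$$ where $G(\nu)=G(\nu;c,d)$ is taken over $(S_1,\Sigma_1,\mu_1)$. In other words, $T$ is bounded from $G(\psi)$ into $G(\nu)$.
   Context: $(S_1,\Sigma_1,\mu_1)$ and $(S_2,\Sigma_2,\mu_2)$ are measurable spaces with sigma-finite non-trivial measures, and $|f|_{p,\mu}=(\int|f|^p\,d\mu)^{1/p}$ for $p\in[1,\infty)$. The kernel $K:S_1\times S_2\to\mathbb{R}$ is measurable with respect to $\Sigma_1\times\Sigma_2$, and $T[f](s)=\int_{S_2}K(s,s_2)f(s_2)\,d\mu_2(s_2)$, $s\in S_1$. For $p,q\in[1,\infty)$, $|T|_{q\to p}=\sup\{|T[f]|_{p,\mu_1}/|f|_{q,\mu_2}: f\in L_q(\mu_2),\ f\neq0\}\in[0,\infty]$ is the norm of $T$ from $L_q(\mu_2)$ to $L_p(\mu_1)$ (equal to $+\infty$ if $T$ is not bounded between these spaces); it is assumed that $|T|_{q\to p}<\infty$ for at least one pair $(q,p)$. For $1\le a<b\le\infty$, $\Psi(a,b)$ is the set of continuous positive functions $\psi$ on $(a,b)$ such that the limits $\psi(a+0)$, $\psi(b-0)$ exist (finite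 or infinite), $\inf_{p\in(a,b)}\psi(p)>0$ and $\min\{\psi(a+0),\psi(b-0)\}>0$. The Bilateral Grand Lebesgue space $G(\psi)=G(\psi;a,b)$ over a measure space consists of all measurable functions $f$ with finite norm $\|f\|G(\psi)=\sup_{p\in(a,b)}|f|_p/\psi(p)$. Set $c=\inf\{p\ge1:\nu(p)<\infty\}$ and $d=\sup\{p\ge1:\nu(p)<\infty\}$, and $\|u\|G(\nu)=\sup_{p\in(c,d)}|u|_{p,\mu_1}/\nu(p)$, with the conventions $C/\infty=0$ and $0/0=0$. *)

theory Defs
  imports "HOL-Analysis.Analysis"
begin

text \<open>
  Exponents range over the reals; the end points of exponent intervals are extended reals, and the
  open interval with end points \<open>a\<close> and \<open>b\<close> is \<open>einterval a b\<close>, a set of reals.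
  Norms take values in \<open>ennreal\<close>.
\<close>

definition Lp_norm :: "'a measure \<Rightarrow> real \<Rightarrow> ('a \<Rightarrow> real) \<Rightarrow> ennreal" where
  "Lp_norm M p f =
     (let I = (\<integral>\<^sup>+ x. ennreal (\<bar>f x\<bar> powr p) \<partial>M)
      in if I = \<infinity> then \<infinity> else ennreal (enn2real I powr (1 / p)))"

definition Lp_space :: "'a measure \<Rightarrow> real \<Rightarrow> ('a \<Rightarrow> real) set" where
  "Lp_space M p = {f \<in> borel_measurable M. Lp_norm M p f < \<infinity>}"

definition int_op :: "'b measure \<Rightarrow> ('a \<times> 'b \<Rightarrow> real) \<Rightarrow> ('b \<Rightarrow> real) \<Rightarrow> 'a \<Rightarrow> real" where
  "int_op M2 K f s = (\<integral>t. K (s, t) * f t \<partial>M2)"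

text \<open>
  The Bochner integral in \<open>int_op\<close> is 0 where the integrand is not integrable.  The first case
  below prevents this from counting as a value of the operator: the norm from \<open>L\<^sub>q\<close> to \<open>L\<^sub>p\<close> is
  infinite unless the integral exists almost everywhere for each \<open>f\<close> in \<open>L\<^sub>q\<close>.  The condition
  \<open>f \<noteq> 0\<close> is understood in \<open>L\<^sub>q\<close>, that is, modulo null sets.
\<close>

definition op_norm ::
  "'a measure \<Rightarrow> 'b measure \<Rightarrow> ('a \<times> 'b \<Rightarrow> real) \<Rightarrow> real \<Rightarrow> real \<Rightarrow> ennreal" where
  "op_norm M1 M2 K q p =
     (if \<exists>f\<in>Lp_space M2 q. \<not> (AE s in M1. integrable M2 (\<lambda>t. K (s, t) * f t)) then \<infinity>
      else (SUP f\<in>{f \<in> Lp_space M2 q. \<not> (AE t in M2. f t = 0)}.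
              Lp_norm M1 p (int_op M2 K f) / Lp_norm M2 q f))"

text \<open>
  The one-sided limits are taken in the extended reals; precomposing with \<open>real_of_ereal\<close> covers
  an infinite right end point.
\<close>

definition Psi_class :: "ereal \<Rightarrow> ereal \<Rightarrow> (real \<Rightarrow> real) set" where
  "Psi_class a b =
     {\<psi>. continuous_on (einterval a b) \<psi> \<and>
         (\<forall>p\<in>einterval a b. 0 < \<psi> p) \<and>
         0 < (INF p\<in>einterval a b. ereal (\<psi> p)) \<and>
         (\<exists>la lb :: ereal.
            ((\<lambda>x. ereal (\<psi> (real_of_ereal x))) \<longlongrightarrow> la) (at_right a) \<and>
            ((\<lambda>x. ereal (\<psi> (real_of_ereal x))) \<longlongrightarrow> lb) (at_left b) \<and>
            0 < min la lb)}"

text \<open>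
  Division in \<open>ennreal\<close> satisfies \<open>C / \<infinity> = 0\<close> (also for \<open>C = \<infinity>\<close>), \<open>0 / 0 = 0\<close>, and
  \<open>C / 0 = \<infinity>\<close> for \<open>C \<noteq> 0\<close>.
\<close>

definition GL_norm ::
  "'a measure \<Rightarrow> ereal \<Rightarrow> ereal \<Rightarrow> (real \<Rightarrow> ennreal) \<Rightarrow> ('a \<Rightarrow> real) \<Rightarrow> ennreal" where
  "GL_norm M a b \<psi> f = (SUP p\<in>einterval a b. Lp_norm M p f / \<psi> p)"

definition GL_space ::
  "'a measure \<Rightarrow> ereal \<Rightarrow> ereal \<Rightarrow> (real \<Rightarrow> ennreal) \<Rightarrow> ('a \<Rightarrow> real) set" where
  "GL_space M a b \<psi> = {f \<in> borel_measurable M. GL_norm M a b \<psi> f < \<infinity>}"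

definition nu ::
  "'a measure \<Rightarrow> 'b measure \<Rightarrow> ('a \<times> 'b \<Rightarrow> real) \<Rightarrow> ereal \<Rightarrow> ereal \<Rightarrow> (real \<Rightarrow> real)
    \<Rightarrow> real \<Rightarrow> ennreal" where
  "nu M1 M2 K a b \<psi> p = (INF q\<in>einterval a b. op_norm M1 M2 K q p * ennreal (\<psi> q))"

text \<open>
  If \<open>\<nu>\<close> is finite for no \<open>p \<ge> 1\<close>, then \<open>lower_end \<nu> = \<infinity>\<close> and \<open>upper_end \<nu> = -\<infinity>\<close>, so the interval
  between them is empty and the corresponding \<open>GL_norm\<close> is 0.
\<close>

definition lower_end :: "(real \<Rightarrow> ennreal) \<Rightarrow> ereal" where
  "lower_end \<nu> = Inf (ereal ` {p. 1 \<le> p \<and> \<nu> p < \<infinity>})"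

definition upper_end :: "(real \<Rightarrow> ennreal) \<Rightarrow> ereal" where
  "upper_end \<nu> = Sup (ereal ` {p. 1 \<le> p \<and> \<nu> p < \<infinity>})"

end

theory Submission
  imports Defs
begin

text \<open>
  The definition of the operator norm gives
  \<open>|T f|\<^sub>p \<le> |T|\<^bsub>q\<rightarrow>p\<^esub> |f|\<^sub>q \<le> |T|\<^bsub>q\<rightarrow>p\<^esub> \<psi> q \<parallel>f\<parallel>\<close> for each \<open>q\<close> in \<open>(a, b)\<close>, and the left-hand
  side does not depend on \<open>q\<close>: take the infimum over \<open>q\<close>, then divide by \<open>\<nu> p\<close>.
\<close>

lemma ennreal_divide_mult_cancel:
  fixes x y :: ennreal
  assumes "y \<noteq> 0" "y \<noteq> \<infinity>"
  shows "x / y * y = x"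
  using assms by (simp add: ennreal_divide_times ennreal_divide_self top.not_eq_extremum)

text \<open>Both finiteness assumptions guard a degenerate quotient. For \<open>y = 0\<close> the
  quotient is \<infinity> unless \<open>x = 0\<close>, so a finite \<open>z\<close> forces
  \<open>x = 0\<close>. For \<open>y = \<infinity>\<close> the quotient is 0 and would say nothing
  about \<open>x\<close>.\<close>

lemma ennreal_le_mult_of_divide_le:
  fixes x y z :: ennreal
  assumes "x / y \<le> z" "y \<noteq> \<infinity>" "z \<noteq> \<infinity>"
  shows "x \<le> z * y"
proof (cases "y = 0")
  case True
  with assms have "x = 0"
    by (auto simp: ennreal_divide_zero top_unique split: if_splits)
  then show ?thesis by simp
next
  case False
  then have "x = x / y * y"
    using ennreal_divide_mult_cancel assms(2) by simp
  also have "\<dots> \<le> z * y"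
    using assms(1) by (rule mult_right_mono) simp
  finally show ?thesis .
qed

text \<open>This direction survives the degenerate cases: if \<open>y = 0\<close> then
  \<open>x = 0\<close>, and 0 / 0 = 0; if \<open>y = \<infinity>\<close>, the quotient is 0.\<close>

lemma ennreal_divide_le_of_le_mult:
  fixes x y z :: ennreal
  assumes "x \<le> z * y"
  shows "x / y \<le> z"
proof (cases "y = 0")
  case True
  with assms show ?thesis by simp
next
  case False
  with assms show ?thesis
    by (intro divide_le_posI_ennreal) (auto simp: zero_less_iff_neq_zero mult.commute)
qed

lemma Lp_norm_zero: "Lp_norm M p (\<lambda>_. 0) = 0"
  by (simp add: Lp_norm_def)

lemma int_op_AE_zero:
  assumes "AE t in M2. f t = 0"
  shows "int_op M2 K f = (\<lambda>_. 0)"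
proof
  fix s
  show "int_op M2 K f s = 0"
    unfolding int_op_def by (rule integral_eq_zero_AE) (use assms in auto)
qed

lemma Lp_norm_int_op_le:
  assumes f: "f \<in> Lp_space M2 q" and fin: "op_norm M1 M2 K q p < \<infinity>"
  shows "Lp_norm M1 p (int_op M2 K f) \<le> op_norm M1 M2 K q p * Lp_norm M2 q f"
\<comment> \<open>Null functions are excluded from the supremum in \<open>op_norm\<close>, so they
  are treated apart: their image vanishes at every point.\<close>
proof (cases "AE t in M2. f t = 0")
  case True
  then show ?thesis
    by (simp add: int_op_AE_zero Lp_norm_zero)
next
  case False
  \<comment> \<open>A finite norm rules out the branch of \<open>op_norm\<close> in which the
    integral fails to exist.\<close>
  have "op_norm M1 M2 K q p =
      (SUP f\<in>{f \<in> Lp_space M2 q. \<not> (AE t in M2. f t = 0)}.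
         Lp_norm M1 p (int_op M2 K f) / Lp_norm M2 q f)"
    using fin unfolding op_norm_def by (auto split: if_splits)
  then have "Lp_norm M1 p (int_op M2 K f) / Lp_norm M2 q f \<le> op_norm M1 M2 K q p"
    using f False by (auto intro!: SUP_upper)
  moreover have "Lp_norm M2 q f \<noteq> \<infinity>"
    using f by (auto simp: Lp_space_def)
  ultimately show ?thesis
    using fin by (intro ennreal_le_mult_of_divide_le) auto
qed

lemma Lp_norm_le_GL_norm:
  assumes "f \<in> GL_space M a b \<psi>" "q \<in> einterval a b" "\<psi> q \<noteq> \<infinity>"
  shows "Lp_norm M q f \<le> GL_norm M a b \<psi> f * \<psi> q"
proof (rule ennreal_le_mult_of_divide_le)
  show "Lp_norm M q f / \<psi> q \<le> GL_norm M a b \<psi> f"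
    unfolding GL_norm_def using assms(2) by (rule SUP_upper)
qed (use assms in \<open>auto simp: GL_space_def\<close>)

text \<open>This is the measurability part of Fubini's theorem. It covers all \<open>s\<close>,
  since the Bochner integral is 0 where the integrand is not integrable.\<close>

lemma borel_measurable_int_op:
  assumes "sigma_finite_measure M2"
    and [measurable]: "K \<in> borel_measurable (M1 \<Otimes>\<^sub>M M2)" "f \<in> borel_measurable M2"
  shows "int_op M2 K f \<in> borel_measurable M1"
proof -
  interpret sigma_finite_measure M2 by fact
  have "(\<lambda>s. \<integral>t. K (s, t) * f t \<partial>M2) \<in> borel_measurable M1"
    by measurable
  then show ?thesis
    unfolding int_op_def[abs_def] .
qed

lemma Lp_norm_int_op_le_nu:
  assumes pos: "\<And>q. q \<in> einterval a b \<Longrightarrow> 0 < \<psi> q"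
    and f: "f \<in> GL_space M2 a b (\<lambda>q. ennreal (\<psi> q))"
    and fin: "nu M1 M2 K a b \<psi> p < \<infinity>"
  shows "Lp_norm M1 p (int_op M2 K f)
    \<le> GL_norm M2 a b (\<lambda>q. ennreal (\<psi> q)) f * nu M1 M2 K a b \<psi> p"
proof -
  define G where "G = GL_norm M2 a b (\<lambda>q. ennreal (\<psi> q)) f"
  define L where "L = Lp_norm M1 p (int_op M2 K f)"
  let ?y = "\<lambda>q. op_norm M1 M2 K q p * ennreal (\<psi> q)"
  have G: "G \<noteq> \<infinity>"
    using f by (auto simp: G_def GL_space_def)
  have le: "L \<le> G * ?y q" if q: "q \<in> einterval a b" and y: "?y q < \<infinity>" for q
  proof -
    \<comment> \<open>Since \<infinity> * 0 = 0, a zero weight could hide an infinite operator norm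
      in the finite product \<open>?y q\<close>.\<close>
    have "ennreal (\<psi> q) \<noteq> 0"
      using pos[OF q] by simp
    then have op: "op_norm M1 M2 K q p < \<infinity>"
      using y by (auto simp: ennreal_mult_less_top)
    have Lq: "Lp_norm M2 q f \<le> G * ennreal (\<psi> q)"
      unfolding G_def using f q by (intro Lp_norm_le_GL_norm) auto
    also have "\<dots> < \<infinity>"
      using G by (simp add: ennreal_mult_less_top top.not_eq_extremum)
    finally have "f \<in> Lp_space M2 q"
      using f by (simp add: Lp_space_def GL_space_def)
    then have "L \<le> op_norm M1 M2 K q p * Lp_norm M2 q f"
      unfolding L_def using op by (rule Lp_norm_int_op_le)
    also have "\<dots> \<le> op_norm M1 M2 K q p * (G * ennreal (\<psi> q))"
      using Lq by (rule mult_left_mono) simp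
    finally show ?thesis
      by (simp add: ac_simps)
  qed
  have "L \<le> G * nu M1 M2 K a b \<psi> p"
  proof (cases "G = 0")
    case True
    \<comment> \<open>Here \<open>0 * \<infinity> = 0\<close>, so the estimate needs an exponent at which the norm is finite.\<close>
    obtain q where "q \<in> einterval a b" "?y q < \<infinity>"
      using fin by (auto simp: nu_def INF_less_iff)
    from le[OF this] True show ?thesis by simp
  next
    case False
    \<comment> \<open>Dividing by \<open>G\<close> first leaves a lower bound for each term of the
      infimum, so no constant has to be pulled through it. Terms with
      \<open>?y q = \<infinity>\<close> are bounded trivially.\<close>
    have "L / G \<le> nu M1 M2 K a b \<psi> p"
      unfolding nu_def
    proof (rule INF_greatest)
      fix q assume q: "q \<in> einterval a b"
      show "L / G \<le> ?y q"
      proof (cases "?y q < \<infinity>")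
        case True
        with le[OF q] show ?thesis
          by (intro ennreal_divide_le_of_le_mult) (simp add: mult.commute)
      next
        case False
        then show ?thesis by (simp add: not_less top_unique)
      qed
    qed
    then show ?thesis
      using G fin ennreal_le_mult_of_divide_le[of L G "nu M1 M2 K a b \<psi> p"]
      by (simp add: mult.commute)
  qed
  then show ?thesis
    by (simp add: L_def G_def)
qed

theorem theorem1:
  fixes M1 :: "'a measure" and M2 :: "'b measure"
    and K :: "'a \<times> 'b \<Rightarrow> real" and a b :: ereal and \<psi> :: "real \<Rightarrow> real"
    and f :: "'b \<Rightarrow> real"
  assumes "sigma_finite_measure M1" and "sigma_finite_measure M2"
    and "emeasure M1 (space M1) \<noteq> 0" and "emeasure M2 (space M2) \<noteq> 0"
    and "K \<in> borel_measurable (M1 \<Otimes>\<^sub>M M2)"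
    and "\<exists>q p. 1 \<le> q \<and> 1 \<le> p \<and> op_norm M1 M2 K q p < \<infinity>"
    and "1 \<le> a" and "a < b"
    and "\<psi> \<in> Psi_class a b"
    and "f \<in> GL_space M2 a b (\<lambda>q. ennreal (\<psi> q))"
  shows "let \<nu> = nu M1 M2 K a b \<psi>; c = lower_end \<nu>; d = upper_end \<nu> in
           int_op M2 K f \<in> GL_space M1 c d \<nu> \<and>
           GL_norm M1 c d \<nu> (int_op M2 K f) \<le> GL_norm M2 a b (\<lambda>q. ennreal (\<psi> q)) f"
proof -
  let ?\<nu> = "nu M1 M2 K a b \<psi>"
  let ?c = "lower_end ?\<nu>" and ?d = "upper_end ?\<nu>"
  let ?G = "GL_norm M2 a b (\<lambda>q. ennreal (\<psi> q)) f"
  have pos: "0 < \<psi> q" if "q \<in> einterval a b" for q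
    using assms(9) that by (auto simp: Psi_class_def)
  have f: "f \<in> borel_measurable M2" "?G < \<infinity>"
    using assms(10) by (auto simp: GL_space_def)
  have le: "GL_norm M1 ?c ?d ?\<nu> (int_op M2 K f) \<le> ?G"
    unfolding GL_norm_def[of M1]
  proof (rule SUP_least)
    fix p
    show "Lp_norm M1 p (int_op M2 K f) / ?\<nu> p \<le> ?G"
    proof (cases "?\<nu> p < \<infinity>")
      case True
      with pos assms(10) show ?thesis
        by (intro ennreal_divide_le_of_le_mult Lp_norm_int_op_le_nu)
    next
      \<comment> \<open>An infinite value of \<open>?\<nu>\<close> between \<open>?c\<close> and
        \<open>?d\<close> does no harm, because C / \<infinity> = 0.\<close>
      case False
      then have "?\<nu> p = top"
        by (simp add: not_less top_unique)
      then show ?thesis by simp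
    qed
  qed
  moreover have "int_op M2 K f \<in> borel_measurable M1"
    using assms(2,5) f(1) by (rule borel_measurable_int_op)
  ultimately show ?thesis
    using f(2) by (simp add: Let_def GL_space_def le_less_trans)
qed

end
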